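(* Let $A\in\mathbb{R}^{n\times n}$ and $B\in\mathbb{R}^{n\times s}$ be constant matrices, and let $\mathcal{V}_m$, $\mathcal{T}_m$, $T_{m+1,m}$ be produced by $m$ steps of the block Arnoldi ($d=s$) or extended block Arnoldi ($d=2s$) algorithm applied to $(A,B)$, as described in the context. Let $B_m=\mathcal{V}_m^TB$, $$G_m(t)=\int_{t_0}^t e^{(t-\tau)\mathcal{T}_m}B_mB_m^Te^{(t-\tau)\mathcal{T}_m^T}\,d\tau,\qquad X_m(t)=\mathcal{V}_mG_m(t)\mathcal{V}_m^T,$$ and let $R_m(t)=\dot X_m(t)-AX_m(t)-X_m(t)A^T-BB^T$ be the residual. Then for all $t\in[t_0,T_f]$ $$\|R_m(t)\|=\|T_{m+1,m}\,\bar G_m(t)\|,$$ where $\bar G_m(t)$ is the $d\times md$ matrix formed by the last $d$ rows of $G_m(t)$, and $\|\cdot\|$ is the spectral (matrix 2-) norm.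
   Context: $B$ has full rank. The block Krylov subspace is $\mathbb{K}_m(A,B)=\mathrm{range}(B,AB,\dots,A^{m-1}B)$; the extended block Krylov subspace (requiring $A$ nonsingular) is $\mathcal{K}_m(A,B)=\mathrm{range}(A^{-m}B,\dots,A^{-1}B,B,AB,\dots,A^{m-1}B)$. The block Arnoldi algorithm ($d=s$), respectively the extended block Arnoldi algorithm ($d=2s$), produces blocks $V_1,\dots,V_{m+1}\in\mathbb{R}^{n\times d}$ such that $\mathcal{V}_{m+1}=[V_1,\dots,V_{m+1}]$ has orthonormal columns, the columns of $\mathcal{V}_m=[V_1,\dots,V_m]$ form an orthonormal basis of $\mathbb{K}_m(A,B)$, respectively $\mathcal{K}_m(A,B)$ (so the columns of $B$ lie in the range of $\mathcal{V}_m$), and $$A\mathcal{V}_m=\mathcal{V}_m\mathcal{T}_m+V_{m+1}T_{m+1,m}E_m^T,$$ where $\mathcal{T}_m=\mathcal{V}_m^TA\mathcal{V}_m\in\mathbb{R}^{md\times md}$ is block upper Hessenberg, $T_{m+1,m}=V_{m+1}^TAV_m\in\mathbb{R}^{d\times d}$, and $E_m=[0_{d\times(m-1)d},I_d]^T$ consists of the last $d$ columns of $I_{md}$. *)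

theory Defs
  imports "HOL-Analysis.Analysis"
begin

text \<open>The overloaded product on real^'n^'n, hence \<^const>\<open>power\<close>, is componentwise, so the powers and
  the exponential with respect to the matrix product are defined separately.\<close>

primrec mpow :: "real^'n^'n \<Rightarrow> nat \<Rightarrow> real^'n^'n" where
  "mpow A 0 = mat 1"
| "mpow A (Suc k) = A ** mpow A k"

definition mexp :: "real^'n^'n \<Rightarrow> real^'n^'n" where
  "mexp A = (\<Sum>k. (1 / fact k) *\<^sub>R mpow A k)"

definition spectral_norm :: "real^'n^'m \<Rightarrow> real" where
  "spectral_norm A = onorm (\<lambda>x. A *v x)"

definition full_rank :: "real^'s^'n \<Rightarrow> bool" where
  "full_rank B \<longleftrightarrow> rank B = min CARD('n) CARD('s)"

definition block_krylov :: "real^'n^'n \<Rightarrow> real^'s^'n \<Rightarrow> nat \<Rightarrow> (real^'n) set" where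
  "block_krylov A B m = span (\<Union>k\<in>{0..<m}. columns (mpow A k ** B))"

definition ext_block_krylov :: "real^'n^'n \<Rightarrow> real^'s^'n \<Rightarrow> nat \<Rightarrow> (real^'n) set" where
  "ext_block_krylov A B m =
     span ((\<Union>k\<in>{1..m}. columns (mpow (matrix_inv A) k ** B)) \<union>
           (\<Union>k\<in>{0..<m}. columns (mpow A k ** B)))"

text \<open>Vectors of length m d consisting of m blocks of size d are indexed by pairs in 'm * 'd, where
  m is the cardinality of the finite linear order 'm and d that of 'd. The first component
  says which block an index belongs to; blocks are numbered 1, ..., m along the order of 'm.\<close>

definition block_no :: "'m::{finite,linorder} \<Rightarrow> nat" where
  "block_no i = card {..i}"

definition block_concat :: "(nat \<Rightarrow> real^'d^'n) \<Rightarrow> real^('m::{finite,linorder} \<times> 'd)^'n" where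
  "block_concat V = (\<chi> r p. V (block_no (fst p)) $ r $ snd p)"

definition last_block :: "real^'d^('m::{finite,linorder} \<times> 'd)" where
  "last_block = (\<chi> p b. if block_no (fst p) = CARD('m) \<and> snd p = b then 1 else 0)"

definition last_rows :: "real^'k^('m::{finite,linorder} \<times> 'd::finite) \<Rightarrow> real^'k^'d" where
  "last_rows G = (\<chi> a. G $ (Max UNIV, a))"

definition block_upper_hessenberg ::
    "real^('m::{finite,linorder} \<times> 'd::finite)^('m \<times> 'd) \<Rightarrow> bool" where
  "block_upper_hessenberg T \<longleftrightarrow>
     (\<forall>i a j b. block_no i > block_no j + 1 \<longrightarrow> T $ (i, a) $ (j, b) = 0)"

text \<open>[V 1, ..., V k] has orthonormal columns.\<close>

definition orthonormal_blocks :: "(nat \<Rightarrow> real^'d^'n) \<Rightarrow> nat \<Rightarrow> bool" where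
  "orthonormal_blocks V k \<longleftrightarrow>
     (\<forall>i\<in>{1..k}. \<forall>j\<in>{1..k}. transpose (V i) ** V j = (if i = j then mat 1 else 0))"

definition projected :: "real^'n^'n \<Rightarrow> real^'k^'n \<Rightarrow> real^'k^'k" where
  "projected A Vm = transpose Vm ** A ** Vm"

definition subdiag_block :: "real^'n^'n \<Rightarrow> (nat \<Rightarrow> real^'d^'n) \<Rightarrow> nat \<Rightarrow> real^'d^'d" where
  "subdiag_block A V m = transpose (V (m + 1)) ** A ** V m"

text \<open>Vm is the matrix [V 1, ..., V m]. Its columns form an orthonormal basis of the subspace K, and
  the further block V (m + 1) closes the Arnoldi relation.\<close>

definition arnoldi_decomposition ::
    "real^'n^'n \<Rightarrow> (real^'n) set \<Rightarrow> (nat \<Rightarrow> real^'d^'n) \<Rightarrow>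
     real^('m::{finite,linorder} \<times> 'd)^'n \<Rightarrow> bool" where
  "arnoldi_decomposition A K V Vm \<longleftrightarrow>
     Vm = block_concat V \<and>
     orthonormal_blocks V (CARD('m) + 1) \<and>
     span (columns Vm) = K \<and>
     block_upper_hessenberg (projected A Vm) \<and>
     A ** Vm = Vm ** projected A Vm
               + V (CARD('m) + 1) ** subdiag_block A V CARD('m)
                   ** transpose (last_block :: real^'d^('m \<times> 'd))"

text \<open>The output of CARD('m) steps of the two algorithms without breakdown.\<close>

definition block_arnoldi ::
    "real^'n^'n \<Rightarrow> real^'s^'n \<Rightarrow> (nat \<Rightarrow> real^'d^'n) \<Rightarrow>
     real^('m::{finite,linorder} \<times> 'd)^'n \<Rightarrow> bool" where
  "block_arnoldi A B V Vm \<longleftrightarrow>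
     CARD('d) = CARD('s) \<and>
     arnoldi_decomposition A (block_krylov A B CARD('m)) V Vm"

definition ext_block_arnoldi ::
    "real^'n^'n \<Rightarrow> real^'s^'n \<Rightarrow> (nat \<Rightarrow> real^'d^'n) \<Rightarrow>
     real^('m::{finite,linorder} \<times> 'd)^'n \<Rightarrow> bool" where
  "ext_block_arnoldi A B V Vm \<longleftrightarrow>
     CARD('d) = 2 * CARD('s) \<and>
     invertible A \<and>
     arnoldi_decomposition A (ext_block_krylov A B CARD('m)) V Vm"

definition gramian :: "real^'k^'k \<Rightarrow> real^'s^'k \<Rightarrow> real \<Rightarrow> real \<Rightarrow> real^'k^'k" where
  "gramian T C t0 t =
     integral {t0..t}
       (\<lambda>\<tau>. mexp ((t - \<tau>) *\<^sub>R T) ** C ** transpose C ** mexp ((t - \<tau>) *\<^sub>R transpose T))"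

text \<open>X is regarded as a function on the interval [t0, Tf], so its derivative is one-sided at
  the end points.\<close>

definition lyapunov_residual ::
    "real^'n^'n \<Rightarrow> real^'s^'n \<Rightarrow> real \<Rightarrow> real \<Rightarrow> (real \<Rightarrow> real^'n^'n) \<Rightarrow> real \<Rightarrow> real^'n^'n" where
  "lyapunov_residual A B t0 Tf X t =
     vector_derivative X (at t within {t0..Tf})
       - A ** X t - X t ** transpose A - B ** transpose B"

end

theory Submission
  imports Defs
begin

text \<open>Since the columns of B lie in the range of Vm, the Lyapunov differential equation for G, multiplied
  by Vm and its transpose, cancels everything in the residual except the remainder of the Arnoldi
  relation. With W = V (m + 1) and S = Tsub ** last_rows (G t) this leaves -(W S Vm' + Vm S' W'), where
  a prime denotes the transpose. Because the columns of Vm and W are jointly orthonormal, this matrix is,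
  in suitable orthonormal bases, the block matrix with S and its transpose off the diagonal, and hence
  has the norm of S.\<close>

section \<open>Matrix products and the spectral norm\<close>

text \<open>As a simp rule this would turn \<open>transpose A *v x\<close> into
  \<open>x v* A\<close>; without it all products keep the form \<open>*v\<close>, to which
  \<open>matrix_vector_mul_assoc\<close> applies.\<close>

declare transpose_matrix_vector [simp del]

lemma bounded_bilinear_matrix_matrix_mult:
  "bounded_bilinear ((**) :: real^'k^'m \<Rightarrow> real^'n^'k \<Rightarrow> real^'n^'m)"
proof -
  have "bilinear ((**) :: real^'k^'m \<Rightarrow> real^'n^'k \<Rightarrow> real^'n^'m)"
    by (auto simp: bilinear_def matrix_matrix_mult_def vec_eq_iff sum.distrib distrib_left
        distrib_right sum_distrib_left mult_ac intro!: linearI)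
  then show ?thesis
    by (simp add: bilinear_conv_bounded_bilinear)
qed

text \<open>Supplies the product rule for derivatives and lets multiplication by a fixed matrix pass
  through derivatives and integrals.\<close>

interpretation matrix_mult: bounded_bilinear "(**) :: real^'k^'m \<Rightarrow> real^'n^'k \<Rightarrow> real^'n^'m"
  by (rule bounded_bilinear_matrix_matrix_mult)

lemma bounded_linear_transpose: "bounded_linear (transpose :: real^'n^'m \<Rightarrow> real^'m^'n)"
proof -
  have "linear (transpose :: real^'n^'m \<Rightarrow> real^'m^'n)"
    by (auto simp: transpose_def vec_eq_iff intro!: linearI)
  then show ?thesis
    by (simp add: linear_conv_bounded_linear)
qed

lemma inner_matrix_vector_mult:
  fixes A :: "real^'n^'m"
  shows "(A *v x) \<bullet> y = x \<bullet> (transpose A *v y)"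
  by (metis dot_lmul_matrix inner_commute transpose_matrix_vector)

lemma norm_matrix_vector_mult_le: "norm (A *v x) \<le> spectral_norm A * norm x"
  unfolding spectral_norm_def by (rule onorm) simp

lemma spectral_norm_nonneg: "0 \<le> spectral_norm A"
  unfolding spectral_norm_def by (rule onorm_pos_le) simp

text \<open>With y = A'x, the square of |y| is the inner product of x and Ay, hence at most |x| |A|
  |y| by Cauchy-Schwarz; dividing by |y| gives the bound.\<close>

lemma norm_transpose_matrix_vector_mult_le:
  fixes A :: "real^'n^'m"
  shows "norm (transpose A *v x) \<le> spectral_norm A * norm x"
proof -
  let ?y = "transpose A *v x"
  have "norm ?y * norm ?y = x \<bullet> (A *v ?y)"
    using inner_matrix_vector_mult[of A ?y x] by (simp add: dot_square_norm inner_commute flip: power2_eq_square)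
  also have "\<dots> \<le> norm x * norm (A *v ?y)"
    by (rule norm_cauchy_schwarz)
  also have "\<dots> \<le> norm x * (spectral_norm A * norm ?y)"
    by (intro mult_left_mono norm_matrix_vector_mult_le) simp
  finally have "norm ?y * norm ?y \<le> (spectral_norm A * norm x) * norm ?y"
    by (simp add: mult_ac)
  then show ?thesis
    using spectral_norm_nonneg[of A]
    by (cases "norm ?y = 0") (auto simp: mult_le_cancel_right)
qed

lemma norm_isometry:
  fixes P :: "real^'k^'n"
  assumes "transpose P ** P = mat 1"
  shows "norm (P *v x) = norm x"
  using assms by (simp add: norm_eq_sqrt_inner inner_matrix_vector_mult matrix_vector_mul_assoc)

text \<open>The ranges of \<open>W\<close> and \<open>P\<close> are orthogonal, so by Pythagoras the
  squared norm of the image of x is that of S P'x plus that of S' W'x. The columns of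
  \<open>P\<close> and \<open>W\<close> may fail to span the space, so the upper bound uses Bessel's
  inequality for the coordinates P'x and W'x. Vectors in the range of \<open>P\<close> give the
  lower bound.\<close>

lemma spectral_norm_offdiagonal:
  fixes P :: "real^'k^'n" and W :: "real^'d^'n" and S :: "real^'k^'d"
  assumes P: "transpose P ** P = mat 1" and W: "transpose W ** W = mat 1"
    and PW: "transpose P ** W = 0"
  shows "spectral_norm (W ** S ** transpose P + P ** transpose S ** transpose W) = spectral_norm S"
    (is "spectral_norm ?M = _")
proof (rule antisym)
  have WP: "transpose W ** P = 0"
    using arg_cong[OF PW, of transpose]
    by (simp add: matrix_transpose_mul) (simp add: transpose_def vec_eq_iff)
  have M: "?M *v x = W *v (S *v (transpose P *v x)) + P *v (transpose S *v (transpose W *v x))" for x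
    by (simp add: matrix_vector_mult_add_rdistrib matrix_vector_mul_assoc matrix_mul_assoc)
  have orth: "(norm (W *v a + P *v b))\<^sup>2 = (norm a)\<^sup>2 + (norm b)\<^sup>2" for a b
  proof -
    have "(W *v a) \<bullet> (P *v b) = 0"
      by (simp add: inner_matrix_vector_mult matrix_vector_mul_assoc WP)
    then have "(norm (W *v a + P *v b))\<^sup>2 = (norm (W *v a))\<^sup>2 + (norm (P *v b))\<^sup>2"
      by (simp add: power2_norm_eq_inner inner_add inner_commute)
    then show ?thesis
      by (simp add: norm_isometry P W)
  qed
  show "spectral_norm ?M \<le> spectral_norm S"
    unfolding spectral_norm_def[of ?M]
  proof (rule onorm_le)
    fix x
    define p w where "p = transpose P *v x" and "w = transpose W *v x"
    \<comment> \<open>\<open>W *v w + P *v p\<close> is the orthogonal projection of x onto the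
      joint range. Its inner product with x is its own squared norm, and Cauchy-Schwarz then yields
      Bessel's inequality.\<close>
    have "(W *v w + P *v p) \<bullet> x = (norm w)\<^sup>2 + (norm p)\<^sup>2"
      by (simp add: inner_add_left inner_matrix_vector_mult p_def w_def power2_norm_eq_inner)
    then have "(norm w)\<^sup>2 + (norm p)\<^sup>2 \<le> norm (W *v w + P *v p) * norm x"
      using norm_cauchy_schwarz[of "W *v w + P *v p" x] by simp
    then have "(norm (W *v w + P *v p))\<^sup>2 \<le> norm (W *v w + P *v p) * norm x"
      by (simp add: orth)
    then have "norm (W *v w + P *v p) \<le> norm x"
      by (cases "norm (W *v w + P *v p) = 0") (auto simp: power2_eq_square mult_le_cancel_left)
    then have bessel: "(norm w)\<^sup>2 + (norm p)\<^sup>2 \<le> (norm x)\<^sup>2"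
      using power_mono[of "norm (W *v w + P *v p)" "norm x" 2] by (simp add: orth)
    have "(norm (?M *v x))\<^sup>2 = (norm (S *v p))\<^sup>2 + (norm (transpose S *v w))\<^sup>2"
      by (simp add: M orth p_def w_def)
    also have "\<dots> \<le> (spectral_norm S * norm p)\<^sup>2 + (spectral_norm S * norm w)\<^sup>2"
      by (intro add_mono power_mono norm_matrix_vector_mult_le norm_transpose_matrix_vector_mult_le) auto
    also have "\<dots> = (spectral_norm S)\<^sup>2 * ((norm w)\<^sup>2 + (norm p)\<^sup>2)"
      by (simp add: algebra_simps power_mult_distrib)
    also have "\<dots> \<le> (spectral_norm S)\<^sup>2 * (norm x)\<^sup>2"
      by (intro mult_left_mono bessel) simp
    finally have "(norm (?M *v x))\<^sup>2 \<le> (spectral_norm S * norm x)\<^sup>2"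
      by (simp add: power_mult_distrib)
    then show "norm (?M *v x) \<le> spectral_norm S * norm x"
      by (rule power2_le_imp_le) (simp add: spectral_norm_nonneg)
  qed
  show "spectral_norm S \<le> spectral_norm ?M"
    unfolding spectral_norm_def[of S]
  proof (rule onorm_le)
    fix y
    \<comment> \<open>On the range of \<open>P\<close> the second summand vanishes because W'P =
      0.\<close>
    have "?M *v (P *v y) = W *v (S *v y)"
      unfolding M by (simp add: matrix_vector_mul_assoc P WP)
    then show "norm (S *v y) \<le> spectral_norm ?M * norm y"
      using norm_matrix_vector_mult_le[of ?M "P *v y"] by (simp add: norm_isometry P W)
  qed
qed

lemma spectral_norm_minus: "spectral_norm (- A) = spectral_norm A"
proof -
  have "(*v) (- A) = (\<lambda>x. - (A *v x))"
    by (auto simp: matrix_vector_mult_def vec_eq_iff sum_negf)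
  then show ?thesis
    by (simp add: spectral_norm_def onorm_neg)
qed

text \<open>P P' is the orthogonal projector onto the column space of \<open>P\<close>: it fixes
  each column of \<open>P\<close>, hence by linearity their span, which contains the columns of
  \<open>B\<close>.\<close>

lemma span_columns_projection:
  fixes P :: "real^'k^'n" and B :: "real^'s^'n"
  assumes P: "transpose P ** P = mat 1" and sub: "columns B \<subseteq> span (columns P)"
  shows "P ** (transpose P ** B) = B"
proof -
  have fix_span: "P *v (transpose P *v x) = x" if "x \<in> span (columns P)" for x
  proof -
    have "subspace {x. P *v (transpose P *v x) = x}"
      by (auto simp: subspace_def matrix_vector_right_distrib matrix_vector_mult_scaleR)
    moreover have "c \<in> {x. P *v (transpose P *v x) = x}" if c: "c \<in> columns P" for c
    proof -
      obtain i where "c = P *v axis i 1"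
        using c by (auto simp: columns_def matrix_vector_mult_basis)
      moreover have "transpose P *v (P *v axis i 1) = axis i 1"
        by (simp add: matrix_vector_mul_assoc P)
      ultimately show ?thesis
        by simp
    qed
    ultimately show ?thesis
      using that span_induct[of x "columns P" "\<lambda>x. P *v (transpose P *v x) = x"] by auto
  qed
  have "column j (P ** (transpose P ** B)) = column j B" for j
  proof -
    have "column j B \<in> span (columns P)"
      using sub by (auto simp: columns_def)
    then have "P *v (transpose P *v (B *v axis j 1)) = B *v axis j 1"
      by (intro fix_span) (simp add: matrix_vector_mult_basis)
    then show ?thesis
      by (simp add: matrix_vector_mul_assoc flip: matrix_vector_mult_basis)
  qed
  then show ?thesis
    by (simp add: column_def vec_eq_iff)
qed

section \<open>The matrix exponential\<close>

lemma mpow_commute: "mpow A k ** A = A ** mpow A k"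
  by (induction k) (simp_all flip: matrix_mul_assoc)

lemma transpose_mpow: "transpose (mpow A k) = mpow (transpose A) k"
  by (induction k) (simp_all add: transpose_mat matrix_transpose_mul mpow_commute flip: matrix_mul_assoc)

lemma mpow_scaleR: "mpow (s *\<^sub>R A) k = s ^ k *\<^sub>R mpow A k"
  by (induction k) (simp_all add: matrix_mult.scaleR_left matrix_mult.scaleR_right mult_ac)

text \<open>A crude geometric bound, enough to dominate the entries of the exponential series by a
  scalar exponential series.\<close>

lemma abs_mpow_component_le:
  "\<bar>mpow A k $ i $ j\<bar> \<le> (\<Sum>i\<in>UNIV. \<Sum>l\<in>UNIV. \<bar>A $ i $ l\<bar>) ^ k"
proof (induction k arbitrary: i)
  case 0
  then show ?case by (simp add: mat_def)
next
  case (Suc k)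
  let ?c = "\<Sum>i\<in>UNIV. \<Sum>l\<in>UNIV. \<bar>A $ i $ l\<bar>"
  have "\<bar>mpow A (Suc k) $ i $ j\<bar> \<le> (\<Sum>l\<in>UNIV. \<bar>A $ i $ l\<bar> * \<bar>mpow A k $ l $ j\<bar>)"
    by (auto simp: matrix_matrix_mult_def abs_mult intro!: order_trans[OF sum_abs])
  also have "\<dots> \<le> (\<Sum>l\<in>UNIV. \<bar>A $ i $ l\<bar> * ?c ^ k)"
    by (intro sum_mono mult_left_mono Suc.IH) simp
  also have "\<dots> = (\<Sum>l\<in>UNIV. \<bar>A $ i $ l\<bar>) * ?c ^ k"
    by (simp add: sum_distrib_right)
  \<comment> \<open>A single row sum is at most the sum over all rows, which makes the constant
    independent of i.\<close>
  also have "\<dots> \<le> ?c * ?c ^ k"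
    by (intro mult_right_mono member_le_sum zero_le_power sum_nonneg) auto
  finally show ?case by simp
qed

lemma summable_mpow_component:
  "summable (\<lambda>k. mpow A k $ i $ j / fact k * s ^ k)"
proof (rule summable_comparison_test')
  let ?c = "\<Sum>i\<in>UNIV. \<Sum>l\<in>UNIV. \<bar>A $ i $ l\<bar>"
  show "summable (\<lambda>k. (?c * \<bar>s\<bar>) ^ k /\<^sub>R fact k)"
    by (rule summable_exp_generic)
  show "norm (mpow A k $ i $ j / fact k * s ^ k) \<le> (?c * \<bar>s\<bar>) ^ k /\<^sub>R fact k" if "0 \<le> k" for k
    using mult_right_mono[OF abs_mpow_component_le[of A k i j], of "\<bar>s\<bar> ^ k / fact k"]
    by (simp add: abs_mult power_mult_distrib power_abs divide_simps)
qed

lemma sums_matrix_componentwise: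
  fixes f :: "nat \<Rightarrow> real^'n^'m"
  assumes "\<And>i j. (\<lambda>k. f k $ i $ j) sums (S $ i $ j)"
  shows "f sums S"
  using assms unfolding sums_def by (intro vec_tendstoI) simp

text \<open>Each entry becomes a real power series in s, so that the scalar theory of termwise
  differentiation applies.\<close>

lemma mexp_component:
  "mexp (s *\<^sub>R A) $ i $ j = (\<Sum>k. mpow A k $ i $ j / fact k * s ^ k)"
proof -
  have "(\<lambda>k. (1 / fact k) *\<^sub>R mpow (s *\<^sub>R A) k) sums
      (\<chi> i j. \<Sum>k. mpow A k $ i $ j / fact k * s ^ k)"
    using summable_sums[OF summable_mpow_component[of A]]
    by (intro sums_matrix_componentwise) (simp add: mpow_scaleR mult_ac)
  then show ?thesis
    by (simp add: mexp_def sums_iff)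
qed

lemma mexp_0: "mexp (0 *\<^sub>R A) = mat 1"
  \<comment> \<open>The deleted rules would destroy the argument \<open>0 *\<^sub>R A\<close> and
    the shape coefficient times \<open>0 ^ k\<close>, on which \<open>mexp_component\<close> and
    \<open>powser_zero\<close> match.\<close>
  by (simp add: vec_eq_iff mexp_component powser_zero del: scaleR_zero_left times_divide_eq_left)

lemma transpose_mexp: "transpose (mexp (s *\<^sub>R A)) = mexp (s *\<^sub>R transpose A)"
proof -
  have "mpow (transpose A) k $ i $ j = mpow A k $ j $ i" for k i j
    by (simp flip: transpose_mpow) (simp add: transpose_def)
  moreover have "transpose (mexp (s *\<^sub>R A)) $ i $ j = mexp (s *\<^sub>R A) $ j $ i" for i j
    by (simp add: transpose_def)
  ultimately show ?thesis
    by (simp add: vec_eq_iff mexp_component)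
qed

lemma has_vector_derivative_matrix_componentwise:
  fixes f :: "real \<Rightarrow> real^'n^'m"
  assumes "\<And>i j. ((\<lambda>x. f x $ i $ j) has_real_derivative D $ i $ j) (at x within S)"
  shows "(f has_vector_derivative D) (at x within S)"
  unfolding has_vector_derivative_def has_derivative_componentwise_within[of f]
  using assms
  by (auto simp: Basis_vec_def inner_axis has_field_derivative_def mult_commute_abs)

text \<open>Differentiating the series shifts its index: the new coefficient is the entry of
  \<open>mpow A (Suc k)\<close> over \<open>fact k\<close>, and the recursion of \<open>mpow\<close>
  splits off one factor \<open>A\<close> on the left.\<close>

lemma mexp_has_vector_derivative:
  "((\<lambda>s. mexp (s *\<^sub>R A)) has_vector_derivative A ** mexp (s *\<^sub>R A)) (at s within S)"
proof (rule has_vector_derivative_matrix_componentwise)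
  fix i j
  let ?c = "\<lambda>k. mpow A k $ i $ j / fact k"
  have "diffs ?c k = (\<Sum>l\<in>UNIV. A $ i $ l * (mpow A k $ l $ j / fact k))" for k
  proof -
    have "diffs ?c k = mpow A (Suc k) $ i $ j / fact k"
      by (simp add: diffs_def fact_Suc del: mpow.simps of_nat_Suc)
    then show ?thesis
      by (simp add: matrix_matrix_mult_def sum_divide_distrib)
  qed
  then have "(\<Sum>k. diffs ?c k * s ^ k)
      = (\<Sum>k. \<Sum>l\<in>UNIV. A $ i $ l * (mpow A k $ l $ j / fact k * s ^ k))"
    by (simp add: sum_distrib_left sum_distrib_right mult_ac)
  \<comment> \<open>The finite sum over l and the series over k are interchanged, since each inner
    series is summable.\<close>
  also have "\<dots> = (\<Sum>l\<in>UNIV. A $ i $ l * (\<Sum>k. mpow A k $ l $ j / fact k * s ^ k))"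
    by (subst suminf_sum)
      (simp_all only: summable_mult summable_mpow_component suminf_mult[OF summable_mpow_component])
  also have "\<dots> = (A ** mexp (s *\<^sub>R A)) $ i $ j"
    by (simp add: matrix_matrix_mult_def mexp_component)
  finally show "((\<lambda>s. mexp (s *\<^sub>R A) $ i $ j) has_real_derivative (A ** mexp (s *\<^sub>R A)) $ i $ j) (at s within S)"
    using termdiffs_strong_converges_everywhere[of ?c s, OF summable_mpow_component]
    by (simp add: mexp_component has_field_derivative_at_within)
qed

section \<open>The Gramian and its differential equation\<close>

text \<open>The integrand in terms of the elapsed time u = t - \<tau>. In this variable t enters the
  Gramian only through the upper limit of integration, so no differentiation under the integral sign
  arises.\<close>

definition gramian_kernel :: "real^'k^'k \<Rightarrow> real^'s^'k \<Rightarrow> real \<Rightarrow> real^'k^'k" where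
  "gramian_kernel T C u = mexp (u *\<^sub>R T) ** C ** transpose C ** mexp (u *\<^sub>R transpose T)"

lemma gramian_kernel_0: "gramian_kernel T C 0 = C ** transpose C"
  using mexp_0[of T] mexp_0[of "transpose T"] by (simp add: gramian_kernel_def)

lemma transpose_gramian_kernel: "transpose (gramian_kernel T C u) = gramian_kernel T C u"
  by (simp add: gramian_kernel_def matrix_transpose_mul transpose_mexp matrix_mul_assoc)

lemma gramian_kernel_has_vector_derivative:
  "(gramian_kernel T C has_vector_derivative
      T ** gramian_kernel T C u + gramian_kernel T C u ** transpose T) (at u within S)"
proof -
  let ?E = "\<lambda>u. mexp (u *\<^sub>R T)" and ?D = "C ** transpose C"
  \<comment> \<open>Writing the right factor as the transpose of the left exponential reduces the
    claim to one derivative of \<open>mexp\<close> and the product rule.\<close>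
  have kernel: "gramian_kernel T C = (\<lambda>u. (?E u ** ?D) ** transpose (?E u))"
    by (auto simp: gramian_kernel_def transpose_mexp matrix_mul_assoc)
  have ED: "((\<lambda>u. ?E u ** ?D) has_vector_derivative (T ** ?E u) ** ?D) (at u within S)"
    by (rule bounded_linear.has_vector_derivative[OF matrix_mult.bounded_linear_left
          mexp_has_vector_derivative])
  have Et: "((\<lambda>u. transpose (?E u)) has_vector_derivative transpose (T ** ?E u)) (at u within S)"
    by (rule bounded_linear.has_vector_derivative[OF bounded_linear_transpose
          mexp_has_vector_derivative])
  show ?thesis
    using matrix_mult.has_vector_derivative[OF ED Et]
    by (simp add: kernel matrix_transpose_mul matrix_mul_assoc add.commute)
qed

lemma continuous_on_gramian_kernel: "continuous_on S (gramian_kernel T C)"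
  by (rule continuous_on_vector_derivative) (rule gramian_kernel_has_vector_derivative)

lemma gramian_kernel_integrable: "gramian_kernel T C integrable_on {a..b}"
  by (rule integrable_continuous_real[OF continuous_on_gramian_kernel])

lemma gramian_eq_integral_kernel:
  assumes "t0 \<le> t"
  shows "gramian T C t0 t = integral {0..t - t0} (gramian_kernel T C)"
proof -
  have "(gramian_kernel T C has_integral integral {0..t - t0} (gramian_kernel T C)) (cbox 0 (t - t0))"
    using integrable_integral[OF gramian_kernel_integrable] by simp
  \<comment> \<open>The substitution u = t - \<tau> has slope -1, so the scaling factor is 1 and
    {0..t - t0} corresponds to {t0..t}.\<close>
  from has_integral_affinity[OF this, of "-1" t] assms
  have "((\<lambda>\<tau>. gramian_kernel T C (t - \<tau>)) has_integral integral {0..t - t0} (gramian_kernel T C)) {t0..t}"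
    by simp
  then show ?thesis
    unfolding gramian_def gramian_kernel_def[symmetric] by (rule integral_unique)
qed

lemma transpose_gramian:
  assumes "t0 \<le> t"
  shows "transpose (gramian T C t0 t) = gramian T C t0 t"
  using integral_linear[OF gramian_kernel_integrable[of T C 0 "t - t0"] bounded_linear_transpose, symmetric]
  by (simp add: gramian_eq_integral_kernel assms o_def transpose_gramian_kernel)

text \<open>The kernel F satisfies F' = T F + F T' with F(0) = C C'. Integrating over {0..t - t0}
  and pulling \<open>T\<close> and its transpose out of the integral gives the identity.\<close>

lemma gramian_lyapunov_integrated:
  assumes "t0 \<le> t"
  shows "gramian_kernel T C (t - t0)
    = T ** gramian T C t0 t + gramian T C t0 t ** transpose T + C ** transpose C"
proof -
  let ?F = "gramian_kernel T C" and ?I = "{0..t - t0}"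
  note kernel = integrable_integral[OF gramian_kernel_integrable[of T C 0 "t - t0"]]
  have "((\<lambda>u. T ** ?F u + ?F u ** transpose T) has_integral ?F (t - t0) - ?F 0) ?I"
    using assms by (intro fundamental_theorem_of_calculus gramian_kernel_has_vector_derivative) simp
  moreover have "((\<lambda>u. T ** ?F u + ?F u ** transpose T) has_integral
      T ** integral ?I ?F + integral ?I ?F ** transpose T) ?I"
    using has_integral_add[OF
        has_integral_linear[OF kernel matrix_mult.bounded_linear_right[of T]]
        has_integral_linear[OF kernel matrix_mult.bounded_linear_left[of "transpose T"]]]
    by (simp add: o_def)
  ultimately have "?F (t - t0) - ?F 0 = T ** integral ?I ?F + integral ?I ?F ** transpose T"
    by (rule has_integral_unique)
  then show ?thesis
    by (simp add: gramian_eq_integral_kernel assms gramian_kernel_0 algebra_simps)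
qed

text \<open>The fundamental theorem of calculus gives the kernel at t - t0 as derivative of the
  Gramian; the integrated equation rewrites it as the right-hand side of the Lyapunov
  equation.\<close>

lemma gramian_has_vector_derivative:
  assumes t: "t \<in> {t0..Tf}"
  shows "(gramian T C t0 has_vector_derivative
      T ** gramian T C t0 t + gramian T C t0 t ** transpose T + C ** transpose C)
    (at t within {t0..Tf})"
proof -
  let ?F = "gramian_kernel T C"
  \<comment> \<open>The chain rule for one-sided derivatives takes the outer derivative within the
    image of the interval under the shift.\<close>
  have img: "(\<lambda>t. t - t0) ` {t0..Tf} = {0..Tf - t0}"
    by simp
  have shift: "((\<lambda>t. t - t0) has_vector_derivative 1) (at t within {t0..Tf})"
    by (auto intro!: derivative_eq_intros)
  have "((\<lambda>u. integral {0..u} ?F) has_vector_derivative ?F (t - t0))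
      (at (t - t0) within (\<lambda>t. t - t0) ` {t0..Tf})"
    unfolding img using t by (intro integral_has_vector_derivative continuous_on_gramian_kernel) auto
  from vector_diff_chain_within[OF shift this]
  have "((\<lambda>t. integral {0..t - t0} ?F) has_vector_derivative ?F (t - t0)) (at t within {t0..Tf})"
    by (simp add: o_def)
  then have "(gramian T C t0 has_vector_derivative ?F (t - t0)) (at t within {t0..Tf})"
    by (rule has_vector_derivative_transform[OF t, rotated]) (simp add: gramian_eq_integral_kernel)
  then show ?thesis
    using t by (simp add: gramian_lyapunov_integrated)
qed

section \<open>The Arnoldi decomposition\<close>

text \<open>Initial segments of a linear order are nested, so finite ones of equal cardinality
  coincide.\<close>

lemma block_no_inject: "block_no i = block_no j \<longleftrightarrow> i = j"
proof
  assume "block_no i = block_no j"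
  moreover have "{..i} \<subseteq> {..j} \<or> {..j} \<subseteq> {..i}"
    by auto
  ultimately have "{..i} = {..j}"
    unfolding block_no_def
    using card_subset_eq[of "{..j}" "{..i}"] card_subset_eq[of "{..i}" "{..j}"] by auto
  then show "i = j"
    by simp
qed simp

lemma block_no_bounds: "block_no (i :: 'm::{finite,linorder}) \<in> {1..CARD('m)}"
proof -
  have "0 < card {..i}"
    by (simp add: card_gt_0_iff)
  moreover have "card {..i} \<le> CARD('m)"
    by (intro card_mono) auto
  ultimately show ?thesis
    by (simp add: block_no_def)
qed

text \<open>Reconciles the two descriptions of the last block: by its number in
  \<open>last_block\<close>, by \<open>Max UNIV\<close> in \<open>last_rows\<close>.\<close>

lemma block_no_last: "block_no (i :: 'm::{finite,linorder}) = CARD('m) \<longleftrightarrow> i = Max UNIV"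
proof -
  have "{..Max UNIV} = (UNIV :: 'm set)"
    by auto
  then have "block_no (Max UNIV :: 'm) = CARD('m)"
    by (simp add: block_no_def)
  then show ?thesis
    using block_no_inject[of i "Max UNIV"] by simp
qed

text \<open>Row a of the transposed \<open>last_block\<close> is the unit vector at index (Max UNIV,
  a). This is how the last d rows of the Gramian enter through the Arnoldi remainder.\<close>

lemma transpose_last_block_mult:
  fixes G :: "real^'k^('m::{finite,linorder} \<times> 'd::finite)"
  shows "transpose last_block ** G = last_rows G"
proof -
  have "(\<Sum>p\<in>UNIV. (last_block :: real^'d^('m \<times> 'd)) $ p $ a * G $ p $ q)
      = G $ (Max UNIV, a) $ q" for a :: 'd and q
  proof -
    have "(last_block :: real^'d^('m \<times> 'd)) $ p $ a * G $ p $ q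
        = (if p = (Max UNIV, a) then G $ p $ q else 0)" for p
      by (cases p) (auto simp: last_block_def block_no_last)
    then show ?thesis
      by simp
  qed
  then show ?thesis
    by (simp add: vec_eq_iff matrix_matrix_mult_def transpose_def last_rows_def)
qed

lemma transpose_block_concat_mult:
  "(transpose (block_concat V) ** M) $ p $ q = (transpose (V (block_no (fst p))) ** M) $ snd p $ q"
  by (simp add: block_concat_def matrix_matrix_mult_def transpose_def)

lemma mult_block_concat:
  "(M ** block_concat V) $ p $ q = (M ** V (block_no (fst q))) $ p $ snd q"
  by (simp add: block_concat_def matrix_matrix_mult_def)

text \<open>Splits the joint orthonormality of m + 1 blocks into the three relations that
  \<open>spectral_norm_offdiagonal\<close> requires.\<close>

lemma orthonormal_block_concat:
  fixes V :: "nat \<Rightarrow> real^'d^'n"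
  assumes "orthonormal_blocks V (CARD('m) + 1)"
  defines "P \<equiv> block_concat V :: real^('m::{finite,linorder} \<times> 'd)^'n"
    and "W \<equiv> V (CARD('m) + 1)"
  shows "transpose P ** P = mat 1" "transpose P ** W = 0" "transpose W ** W = mat 1"
proof -
  have V: "transpose (V i) ** V j = (if i = j then mat 1 else 0)"
    if "i \<in> {1..CARD('m) + 1}" "j \<in> {1..CARD('m) + 1}" for i j
    using assms(1) that by (auto simp: orthonormal_blocks_def)
  \<comment> \<open>Indices of \<open>P\<close> carry the block numbers 1 to m only, so the block
    \<open>W\<close> with number m + 1 always differs from them.\<close>
  have range: "block_no i \<in> {1..CARD('m) + 1}" "block_no i \<noteq> CARD('m) + 1" for i :: 'm
    using block_no_bounds[of i] by auto
  have "(transpose P ** P) $ p $ q = mat 1 $ p $ q" for p q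
    unfolding P_def transpose_block_concat_mult mult_block_concat V[OF range(1) range(1)]
    by (cases p; cases q) (auto simp: block_no_inject mat_def)
  then show "transpose P ** P = mat 1"
    by (simp add: vec_eq_iff)
  have "(transpose P ** W) $ p $ q = 0" for p q
    using V[OF range(1)[of "fst p"], of "CARD('m) + 1"] range(2)[of "fst p"]
    by (simp add: P_def W_def transpose_block_concat_mult)
  then show "transpose P ** W = 0"
    by (simp add: vec_eq_iff)
  show "transpose W ** W = mat 1"
    unfolding W_def by (subst V) auto
qed

lemma columns_subset_block_krylov:
  assumes "0 < m"
  shows "columns B \<subseteq> block_krylov A B m"
proof -
  \<comment> \<open>The generator with k = 0 is \<open>B\<close> itself; it is present because m is
    positive.\<close>
  have "columns (mpow A 0 ** B) \<subseteq> (\<Union>k\<in>{0..<m}. columns (mpow A k ** B))"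
    using assms by (intro UN_upper) simp
  then show ?thesis
    by (auto simp: block_krylov_def intro!: span_base)
qed

lemma columns_subset_ext_block_krylov:
  assumes "0 < m"
  shows "columns B \<subseteq> ext_block_krylov A B m"
proof -
  have "columns (mpow A 0 ** B) \<subseteq> (\<Union>k\<in>{0..<m}. columns (mpow A k ** B))"
    using assms by (intro UN_upper) simp
  then show ?thesis
    by (auto simp: ext_block_krylov_def intro!: span_base)
qed

section \<open>The residual of the lifted Gramian\<close>

text \<open>The derivative of P G P' is P (T G + G T' + C C') P'. Replacing A P by P T + N and B by
  P C cancels all of it in the residual and leaves the two terms with the remainder
  \<open>N\<close>.\<close>

lemma lyapunov_residual_galerkin:
  fixes A :: "real^'n^'n" and P :: "real^'k^'n" and T :: "real^'k^'k"
    and N :: "real^'k^'n" and C :: "real^'s^'k"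
  assumes t: "t \<in> {t0..Tf}" and "t0 < Tf"
    and AP: "A ** P = P ** T + N" and B: "P ** C = B"
  shows "lyapunov_residual A B t0 Tf (\<lambda>t. P ** gramian T C t0 t ** transpose P) t
    = - (N ** gramian T C t0 t ** transpose P + P ** gramian T C t0 t ** transpose N)"
proof -
  let ?G = "gramian T C t0 t"
  have "((\<lambda>t. P ** gramian T C t0 t ** transpose P) has_vector_derivative
      P ** (T ** ?G + ?G ** transpose T + C ** transpose C) ** transpose P) (at t within {t0..Tf})"
    using t by (intro bounded_linear.has_vector_derivative[OF matrix_mult.bounded_linear_left]
        bounded_linear.has_vector_derivative[OF matrix_mult.bounded_linear_right]
        gramian_has_vector_derivative)
  then have deriv: "vector_derivative (\<lambda>t. P ** gramian T C t0 t ** transpose P) (at t within {t0..Tf})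
      = P ** (T ** ?G + ?G ** transpose T + C ** transpose C) ** transpose P"
    \<comment> \<open>The interval is nondegenerate because t0 < Tf, so the one-sided derivative is
      unique and \<open>vector_derivative\<close> returns it.\<close>
    using assms(1,2) by (intro vector_derivative_within_closed_interval) auto
  have "A ** (P ** ?G ** transpose P) = (P ** T + N) ** ?G ** transpose P"
    by (simp add: AP matrix_mul_assoc)
  moreover have "P ** ?G ** transpose P ** transpose A = P ** ?G ** transpose (P ** T + N)"
    by (simp add: matrix_transpose_mul flip: AP matrix_mul_assoc)
  moreover have "B ** transpose B = P ** C ** transpose C ** transpose P"
    by (simp add: matrix_transpose_mul matrix_mul_assoc flip: B)
  ultimately show ?thesis
    unfolding lyapunov_residual_def deriv
    by (simp add: matrix_mult.add_left matrix_mult.add_right matrix_transpose_mul matrix_mul_assoc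
        linear_add[OF bounded_linear.linear[OF bounded_linear_transpose]])
qed

theorem theorem2p2:
  fixes A :: "real^'n^'n"
    and B :: "real^'s^'n"
    and V :: "nat \<Rightarrow> real^'d^'n"
    and Vm :: "real^('m::{finite,linorder} \<times> 'd)^'n"
    and Tm :: "real^('m \<times> 'd)^('m \<times> 'd)"
    and Tsub :: "real^'d^'d"
    and Bm :: "real^'s^('m \<times> 'd)"
    and G :: "real \<Rightarrow> real^('m \<times> 'd)^('m \<times> 'd)"
    and X R :: "real \<Rightarrow> real^'n^'n"
    and t0 Tf :: real
  assumes "t0 < Tf"
    and "full_rank B"
    and "block_arnoldi A B V Vm \<or> ext_block_arnoldi A B V Vm"
    and "Tm = projected A Vm"
    and "Tsub = subdiag_block A V CARD('m)"
    and "Bm = transpose Vm ** B"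
    and "G = (\<lambda>t. gramian Tm Bm t0 t)"
    and "X = (\<lambda>t. Vm ** G t ** transpose Vm)"
    and "R = (\<lambda>t. lyapunov_residual A B t0 Tf X t)"
  shows "\<forall>t\<in>{t0..Tf}. spectral_norm (R t) = spectral_norm (Tsub ** last_rows (G t))"
proof
  fix t
  assume t: "t \<in> {t0..Tf}"
  define W where "W = V (CARD('m) + 1)"
  define S where "S = Tsub ** last_rows (G t)"
  \<comment> \<open>Both algorithms are handled at once: \<open>K\<close> is whichever Krylov
    subspace applies, and each contains the columns of \<open>B\<close>.\<close>
  obtain K where K: "arnoldi_decomposition A K V Vm" and BK: "columns B \<subseteq> K"
    using assms(3) columns_subset_block_krylov[of "CARD('m)" B A]
      columns_subset_ext_block_krylov[of "CARD('m)" B A]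
    by (auto simp: block_arnoldi_def ext_block_arnoldi_def)
  have Vm: "Vm = block_concat V" and orth: "orthonormal_blocks V (CARD('m) + 1)"
    and span: "span (columns Vm) = K"
    and AV: "A ** Vm = Vm ** Tm + W ** Tsub ** transpose (last_block :: real^'d^('m \<times> 'd))"
    using K unfolding arnoldi_decomposition_def assms(4,5) W_def by blast+
  note orthonormal = orthonormal_block_concat[where 'm = 'm, OF orth, folded Vm W_def]
  have B: "Vm ** Bm = B"
    unfolding assms(6) using orthonormal(1) BK span by (intro span_columns_projection) auto
  \<comment> \<open>Symmetry of the Gramian makes the second remainder term the transpose of the
    first.\<close>
  have Gt: "transpose (G t) = G t"
    using t by (simp add: assms(7) transpose_gramian)
  let ?E = "last_block :: real^'d^('m \<times> 'd)"
  \<comment> \<open>The Arnoldi remainder times the Gramian: the transposed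
    \<open>last_block\<close> selects the last d rows, leaving W S.\<close>
  have "W ** Tsub ** transpose ?E ** G t = W ** S"
    unfolding S_def by (simp flip: transpose_last_block_mult matrix_mul_assoc)
  moreover from arg_cong[OF this, of transpose]
  have "G t ** transpose (W ** Tsub ** transpose ?E) = transpose S ** transpose W"
    by (simp add: matrix_transpose_mul Gt matrix_mul_assoc)
  moreover have "R t = - (W ** Tsub ** transpose ?E ** G t ** transpose Vm
      + Vm ** G t ** transpose (W ** Tsub ** transpose ?E))"
    unfolding assms(7-9) by (rule lyapunov_residual_galerkin[OF t assms(1) AV B])
  ultimately have "R t = - (W ** S ** transpose Vm + Vm ** transpose S ** transpose W)"
    by (metis matrix_mul_assoc)
  then show "spectral_norm (R t) = spectral_norm (Tsub ** last_rows (G t))"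
    unfolding S_def[symmetric]
    by (simp only: spectral_norm_minus spectral_norm_offdiagonal[OF orthonormal(1,3,2)])
qed

end
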